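(* Let $n$ be a positive integer and let $\Phi:\bigcup_{k=1}^n(\mathbb N^* )^k\to\{1,\dots,n\}$ be a local matching criterion, i.e. a deterministic map with $\Phi(x_1,\dots,x_k)\in\{1,\dots,k\}$ for all $k$ and all $(x_1,\dots,x_k)\in(\mathbb N^* )^k$. Let $\tilde G$ be a balanced bipartite (simple) graph of size $2n$, with node set $V=V^+\cup V^-$, $V^\pm=\{v_1^\pm,\dots,v_n^\pm\}$, and let $\mathbf d^+=(d^+(1),\dots,d^+(n))$ and $\mathbf d^-=(d^-(1),\dots,d^-(n))$ be the degrees in $\tilde G$ of the nodes of the left-hand side $V^+$ and of the right-hand side $V^-$, respectively ($d^\pm(i)$ is the degree of $v_i^\pm$). Let $(\tilde\mu^+_t,\tilde\mu^-_t)_{0\le t\le n}$ be the measure-valued process of the first construction (matching by exploration) with criterion $\Phi$ on $\tilde G$, and let $(\mu^+_t,\mu^-_t)_{0\le t\le n}$ be the measure-valued process of the second construction (joint construction with the configuration model) with criterion $\Phi$ and degrees $\mathbf d^+,\mathbf d^-$, so that these processes have the common initial values $$\tilde\mu_0^+=\mu_0^+=\sum_{i=1}^n\delta_{d^+(i)}\quad\text{and}\quad \tilde\mu_0^-=\mu_0^-=\sum_{i=1}^n\delta_{d^-(i)}.$$ Let $G$ be the resulting multigraph of the second construction. Then, for any $t\in\{0,1,\dots,n\}$ and any couple of measures $(\nu^+,\nu^-)$ (integer-valued finite measures on $\mathbb N$), $$\mathbb P\left[(\mu^+_t,\mu^-_t)=(\nu^+,\nu^-)\mid G=\tilde G\right]=\mathbb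 P\left[(\tilde\mu^+_t,\tilde\mu^-_t)=(\nu^+,\nu^-)\right].$$
   Context: $\mathbb N$ is the set of non-negative integers, $\mathbb N^*=\mathbb N\setminus\{0\}$. A bipartite graph on $V=V^+\cup V^-$ is balanced if $|V^+|=|V^-|$. Graphs have labelled nodes, and $G=\tilde G$ means equality as labelled (multi)graphs on $V$. All random draws mentioned below are independent of the past of the construction. **First construction (on a fixed bipartite simple graph $\tilde G=(V,E)$).** Start with undetermined sets $\tilde U_0^\pm=V^\pm$, and $\tilde U_t=\tilde U_t^+\cup\tilde U_t^-$. Let $\tilde G_t$ be the subgraph of $\tilde G$ induced by $\tilde U_t$; for $v\in\tilde U_t$, $N_t(v)$ is its set of neighbors in $\tilde G_t$ and $d_t(v)=|N_t(v)|$. For $t=0,\dots,n-1$: - Choose $\tilde J^+$ uniformly at random in $\tilde U_t^+$. - If $N_t(\tilde J^+)=\{\tilde J_1^-,\dots,\tilde J_k^-\}$ is non-empty ($k\ge1$), draw a uniformly random permutation $\sigma\in\mathfrak S_k$, set $j=\Phi\big(d_t(\tilde J^-_{\sigma(1)}),\dots,d_t(\tilde J^-_{\sigma(k)})\big)$ and $\tilde J^-=\tilde J^-_{\sigma(j)}$ (the match of $\tilde J^+$), and set $\tilde U_{t+1}=\tilde U_t\setminus\{\tilde J^+,\tilde J^-\}$. - If $N_t(\tilde J^+)=\emptyset$, then $\tilde J^+$ becomes isolated and $\tilde U_{t+1}=\tilde U_t\setminus\{\tilde J^+\}$. The associated measures are, for $0\le t\le n$, $$\tilde\mu_t^+=\sum_{v\in\tilde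 U_t^+}\delta_{d_t(v)},\qquad \tilde\mu_t^-=\sum_{v\in\tilde U_t^-}\delta_{d_t(v)}.$$ **Second construction (joint construction of a multigraph and a matching from degrees $\mathbf d^+,\mathbf d^-$ with $\sum_i d^+(i)=\sum_i d^-(i)$).** Start with $U_0^\pm=V^\pm$, availabilities (numbers of unpaired half-edges) $a_0(v_i^\pm)=d^\pm(i)$, and the edgeless graph on $V$. For $t=0,\dots,n-1$, given undetermined sets $U_t^\pm$ and availabilities $a_t(v)$, $v\in U_t=U_t^+\cup U_t^-$ (the total availability is always the same on both sides): - Choose $J^+$ uniformly at random in $U_t^+$. - If $a_t(J^+)>0$: pair the $a_t(J^+)$ half-edges of $J^+$ with $a_t(J^+)$ half-edges drawn uniformly at random without replacement among all available half-edges of the nodes of $U_t^-$ (node $v$ having $a_t(v)$ of them). Let $\{J_1^-,\dots,J_k^-\}$ be the distinct nodes of $U_t^-$ so reached and let $E_l^-\ge1$ be the number of drawn half-edges belonging to $J_l^-$, so that $J^+$ and $J^-_l$ are joined by $E^-_l$ edges. Draw a uniformly random permutation $\sigma\in\mathfrak S_k$, set $m=\Phi\big(a_t(J^-_{\sigma(1)}),\dots,a_t(J^-_{\sigma(k)})\big)$ and $J^-=J^-_{\sigma(m)}$ (the match of $J^+$). Then pair the remaining $a_t(J^-)-E^-_{\sigma(m)}$ half-edges of $J^-$ (if any) with as many half-edges drawn uniformly at random without replacement among the available half-edges of the nodes of $U_t^+\setminus\{J^+\}$; let $J_1^+,\dots,J_\ell^+$ be the distinct nodes so reached and $E_l^+$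 the number of drawn half-edges of $J_l^+$, so that $J_l^+$ and $J^-$ are joined by $E_l^+$ edges. All these edges are added to the multigraph. Set $U_{t+1}=U_t\setminus\{J^+,J^-\}$, $a_{t+1}(J_l^-)=a_t(J_l^-)-E_l^-$ for the $J_l^-\ne J^-$, $a_{t+1}(J_l^+)=a_t(J_l^+)-E_l^+$ for $1\le l\le\ell$, and $a_{t+1}(v)=a_t(v)$ for the other $v\in U_{t+1}$. - If $a_t(J^+)=0$: $J^+$ becomes isolated, $U_{t+1}=U_t\setminus\{J^+\}$, and no edges or availabilities of other nodes change. After step $n$ all half-edges have been paired, and $G$ denotes the resulting bipartite multigraph on $V$. The associated measures are, for $0\le t\le n$, $$\mu_t^+=\sum_{v\in U_t^+}\delta_{a_t(v)},\qquad \mu_t^-=\sum_{v\in U_t^-}\delta_{a_t(v)}.$$ *)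

theory Defs
  imports "HOL-Probability.Probability" "HOL-Combinatorics.Combinatorics" "HOL-Library.Monad_Syntax"
begin

text \<open>
  The node $v_i^+$ (resp. $v_i^-$) is represented by its index $i \in \{1..n\}$. The edge between
  $v_i^+$ and $v_j^-$ is the pair $(i,j)$, so that a bipartite simple graph is a set of pairs and
  a bipartite multigraph a multiset of pairs.
\<close>

definition bipartite_graph :: "nat \<Rightarrow> (nat \<times> nat) set \<Rightarrow> bool" where
  "bipartite_graph n E \<longleftrightarrow> E \<subseteq> {1..n} \<times> {1..n}"

definition deg_plus :: "(nat \<times> nat) set \<Rightarrow> nat \<Rightarrow> nat" where
  "deg_plus E i = card (E `` {i})"

definition deg_minus :: "(nat \<times> nat) set \<Rightarrow> nat \<Rightarrow> nat" where
  "deg_minus E j = card (E\<inverse> `` {j})"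

definition local_matching_criterion :: "nat \<Rightarrow> (nat list \<Rightarrow> nat) \<Rightarrow> bool" where
  "local_matching_criterion n \<Phi> \<longleftrightarrow>
     (\<forall>xs. 1 \<le> length xs \<and> length xs \<le> n \<and> (\<forall>x\<in>set xs. 0 < x) \<longrightarrow> \<Phi> xs \<in> {1..length xs})"

text \<open>The measure $\sum_{v \in U} \delta_{a(v)}$ on the natural numbers.\<close>

definition sum_dirac :: "nat set \<Rightarrow> (nat \<Rightarrow> nat) \<Rightarrow> nat measure" where
  "sum_dirac U a = distr (count_space U) (count_space UNIV) a"

lemma emeasure_sum_dirac:
  assumes "finite U"
  shows "emeasure (sum_dirac U a) A = (\<Sum>v\<in>U. emeasure (return (count_space UNIV) (a v)) A)"
proof -
  have "emeasure (sum_dirac U a) A = emeasure (count_space U) (a -` A \<inter> U)"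
    unfolding sum_dirac_def by (subst emeasure_distr) auto
  also have "\<dots> = of_nat (card (a -` A \<inter> U))"
    using assms by (subst emeasure_count_space_finite) auto
  also have "\<dots> = (\<Sum>v\<in>U. indicator A (a v))"
    using assms
    by (simp add: indicator_def sum.If_cases Int_def vimage_def conj_commute)
  finally show ?thesis by simp
qed

definition finite_integer_measure :: "nat measure \<Rightarrow> bool" where
  "finite_integer_measure \<nu> \<longleftrightarrow>
     sets \<nu> = UNIV \<and> finite_measure \<nu> \<and> (\<forall>A. measure \<nu> A \<in> \<nat>)"

text \<open>
  The match among the nodes of \<open>N\<close>, enumerated increasingly and then reordered by a uniform
  permutation of the positions. The values of \<open>\<Phi>\<close> start at 1 whereas list positions start at 0.
\<close>

definition choose_match :: "(nat list \<Rightarrow> nat) \<Rightarrow> (nat \<Rightarrow> nat) \<Rightarrow> nat set \<Rightarrow> nat pmf" where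
  "choose_match \<Phi> a N = do {
     \<sigma> \<leftarrow> pmf_of_set {\<sigma>. \<sigma> permutes {..<card N}};
     let xs = permute_list \<sigma> (sorted_list_of_set N);
     return_pmf (xs ! (\<Phi> (map a xs) - 1))
   }"

text \<open>
  The law of the list of states at times \<open>0, \<dots>, m\<close> of the Markov chain with kernel \<open>K\<close>
  started at \<open>s\<close>.
\<close>

primrec trajectory :: "('s \<Rightarrow> 's pmf) \<Rightarrow> nat \<Rightarrow> 's \<Rightarrow> 's list pmf" where
  "trajectory K 0 s = return_pmf [s]"
| "trajectory K (Suc m) s = do {
     s' \<leftarrow> K s;
     ss \<leftarrow> trajectory K m s';
     return_pmf (s # ss)
   }"


subsection \<open>Matching by exploration of a fixed graph\<close>

text \<open>A state is the pair $(U^+, U^-)$ of the sets of undetermined nodes.\<close>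

type_synonym expl_state = "nat set \<times> nat set"

definition induced :: "(nat \<times> nat) set \<Rightarrow> expl_state \<Rightarrow> (nat \<times> nat) set" where
  "induced E s = E \<inter> (fst s \<times> snd s)"

definition expl_step :: "(nat list \<Rightarrow> nat) \<Rightarrow> (nat \<times> nat) set \<Rightarrow> expl_state \<Rightarrow> expl_state pmf" where
  "expl_step \<Phi> E s = do {
     J \<leftarrow> pmf_of_set (fst s);
     let N = induced E s `` {J};
     if N = {} then return_pmf (fst s - {J}, snd s)
     else do {
       J' \<leftarrow> choose_match \<Phi> (deg_minus (induced E s)) N;
       return_pmf (fst s - {J}, snd s - {J'})
     }
   }"

definition exploration :: "nat \<Rightarrow> (nat list \<Rightarrow> nat) \<Rightarrow> (nat \<times> nat) set \<Rightarrow> expl_state list pmf" where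
  "exploration n \<Phi> E = trajectory (expl_step \<Phi> E) n ({1..n}, {1..n})"

definition expl_measure_plus :: "(nat \<times> nat) set \<Rightarrow> expl_state \<Rightarrow> nat measure" where
  "expl_measure_plus E s = sum_dirac (fst s) (deg_plus (induced E s))"

definition expl_measure_minus :: "(nat \<times> nat) set \<Rightarrow> expl_state \<Rightarrow> nat measure" where
  "expl_measure_minus E s = sum_dirac (snd s) (deg_minus (induced E s))"


subsection \<open>Joint construction of the matching and of the configuration model\<close>

record joint_state =
  U_plus :: "nat set"
  U_minus :: "nat set"
  avail_plus :: "nat \<Rightarrow> nat"
  avail_minus :: "nat \<Rightarrow> nat"
  graph :: "(nat \<times> nat) multiset"

text \<open>
  \<open>draw_half_edges U a m\<close> draws without replacement \<open>m\<close> of the half-edges \<open>(v, h)\<close>, \<open>h < a v\<close>,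
  of the nodes \<open>v \<in> U\<close>, and returns the multiset of their nodes: the node \<open>v\<close> is reached iff it
  is an element of that multiset, and its multiplicity there is the number of its drawn half-edges.
\<close>

definition draw_half_edges :: "nat set \<Rightarrow> (nat \<Rightarrow> nat) \<Rightarrow> nat \<Rightarrow> nat multiset pmf" where
  "draw_half_edges U a m =
     map_pmf (\<lambda>H. image_mset fst (mset_set H))
       (pmf_of_set {H. H \<subseteq> (SIGMA v:U. {..<a v}) \<and> card H = m})"

text \<open>
  Only the availabilities of the undetermined nodes are meaningful; the entries left at the nodes
  that have been removed are never read again.
\<close>

definition joint_step :: "(nat list \<Rightarrow> nat) \<Rightarrow> joint_state \<Rightarrow> joint_state pmf" where
  "joint_step \<Phi> s = do {
     J \<leftarrow> pmf_of_set (U_plus s);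
     if avail_plus s J = 0 then return_pmf (s\<lparr>U_plus := U_plus s - {J}\<rparr>)
     else do {
       D \<leftarrow> draw_half_edges (U_minus s) (avail_minus s) (avail_plus s J);
       J' \<leftarrow> choose_match \<Phi> (avail_minus s) (set_mset D);
       D' \<leftarrow> draw_half_edges (U_plus s - {J}) (avail_plus s) (avail_minus s J' - count D J');
       return_pmf
         \<lparr>U_plus = U_plus s - {J},
          U_minus = U_minus s - {J'},
          avail_plus = (\<lambda>v. avail_plus s v - count D' v),
          avail_minus = (\<lambda>v. avail_minus s v - count D v),
          graph = graph s + image_mset (\<lambda>v. (J, v)) D + image_mset (\<lambda>v. (v, J')) D'\<rparr>
     }
   }"

definition joint_construction ::
    "nat \<Rightarrow> (nat list \<Rightarrow> nat) \<Rightarrow> (nat \<Rightarrow> nat) \<Rightarrow> (nat \<Rightarrow> nat) \<Rightarrow> joint_state list pmf" where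
  "joint_construction n \<Phi> dp dm =
     trajectory (joint_step \<Phi>) n
       \<lparr>U_plus = {1..n}, U_minus = {1..n}, avail_plus = dp, avail_minus = dm, graph = {#}\<rparr>"

definition joint_measure_plus :: "joint_state \<Rightarrow> nat measure" where
  "joint_measure_plus s = sum_dirac (U_plus s) (avail_plus s)"

definition joint_measure_minus :: "joint_state \<Rightarrow> nat measure" where
  "joint_measure_minus s = sum_dirac (U_minus s) (avail_minus s)"

end

theory Submission
  imports Defs
begin

text \<open>
  Fix a simple graph \<open>E\<close> and follow the joint construction as long as what it has revealed is
  compatible with \<open>E\<close>. Then the edges at the nodes already removed are exactly those of \<open>E\<close>, and the
  availabilities of the undetermined nodes are their degrees in the subgraph of \<open>E\<close> induced by them.
  So the pair of measures is the one of the exploration, as is the input of the criterion \<open>\<Phi>\<close>, and it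
  remains to understand the effect of conditioning on the completion of the graph to \<open>E\<close>.

  The edges of a bipartite configuration model may be revealed in any order, so the chance of such a
  completion depends on the undetermined sets alone: for a remaining graph \<open>F\<close> it is \<open>c F\<close>, the product
  of the factorials of the degrees of all undetermined nodes, divided by the factorial of the number
  of edges of \<open>F\<close> (\<open>configuration_prob\<close>). Here this is proved without the uniform pairing, from a
  one-step recursion (\<open>configuration_prob_step\<close>): if $J^+$ has the set of neighbours $N$ and is matched
  with $J^- \in N$, then \<open>c F\<close> is the probability of drawing one half-edge of each node of $N$, times
  the probability of drawing afterwards one half-edge of each other neighbour of $J^-$, times \<open>c\<close> of
  the graph without $J^+$ and $J^-$. The point is that this product does not depend on $J^+$ and
  $J^-$. The Doob transform of the joint construction by \<open>c\<close> therefore chooses $J^+$ and $J^-$ with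
  the same law as the exploration (\<open>joint_step_expl_step\<close>). A step that draws anything else settles a
  wrong edge (\<open>reveal_agrees_imp\<close>), and settled edges never change (\<open>trajectory_settles\<close>), so it makes
  the completion to \<open>E\<close> impossible.

  By induction on the number of steps, the joint law of the measures of the joint construction and of
  the event $G = E$ is \<open>c\<close> of the initial state times the law of the measures of the exploration
  (\<open>trajectory_joint_expl\<close>). As the functional of the trajectory is arbitrary there, the constant
  functional 1 shows that $G = E$ has probability exactly this constant, which is positive;
  division gives the conditional law.
\<close>

section \<open>Drawing half-edges\<close>

lemma image_mset_eq_mset_set_iff:
  assumes "finite H" "finite N"
  shows "image_mset f (mset_set H) = mset_set N \<longleftrightarrow> inj_on f H \<and> f ` H = N"
proof
  assume eq: "image_mset f (mset_set H) = mset_set N"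
  have "set_mset (image_mset f (mset_set H)) = set_mset (mset_set N)"
    using eq by simp
  then have im: "f ` H = N"
    using assms by simp
  have "card H = card N"
    using arg_cong[OF eq, of size] by simp
  then show "inj_on f H \<and> f ` H = N"
    using im assms(1) by (auto intro: eq_card_imp_inj_on)
next
  assume "inj_on f H \<and> f ` H = N"
  then show "image_mset f (mset_set H) = mset_set N"
    by (auto simp: image_mset_mset_set)
qed

text \<open>
  A set of half-edges that reaches every node of \<open>N\<close> exactly once and no other node is the graph of a
  function that picks one half-edge of each node of \<open>N\<close>.
\<close>

lemma card_half_edge_choices:
  fixes a :: "nat \<Rightarrow> nat"
  assumes "finite U" "N \<subseteq> U"
  shows "card {H. H \<subseteq> (SIGMA v:U. {..<a v}) \<and> image_mset fst (mset_set H) = mset_set N}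
       = (\<Prod>v\<in>N. a v)" (is "card ?S = _")
proof -
  have finN: "finite N"
    using assms finite_subset by blast
  have fin: "finite H" if "H \<subseteq> (SIGMA v:U. {..<a v})" for H
    using that assms(1) by (auto intro: finite_subset)
  have "bij_betw (\<lambda>\<phi>. (\<lambda>v. (v, \<phi> v)) ` N) (PiE N (\<lambda>v. {..<a v})) ?S"
  proof (rule bij_betw_imageI)
    show "inj_on (\<lambda>\<phi>. (\<lambda>v. (v, \<phi> v)) ` N) (PiE N (\<lambda>v. {..<a v}))"
    proof (rule inj_onI)
      fix \<phi> \<psi> assume *: "\<phi> \<in> PiE N (\<lambda>v. {..<a v})" "\<psi> \<in> PiE N (\<lambda>v. {..<a v})"
        "(\<lambda>v. (v, \<phi> v)) ` N = (\<lambda>v. (v, \<psi> v)) ` N"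
      show "\<phi> = \<psi>"
      proof (rule PiE_ext[OF *(1,2)])
        fix v assume "v \<in> N"
        then have "(v, \<phi> v) \<in> (\<lambda>v. (v, \<psi> v)) ` N"
          using *(3) by blast
        then show "\<phi> v = \<psi> v" by auto
      qed
    qed
    show "(\<lambda>\<phi>. (\<lambda>v. (v, \<phi> v)) ` N) ` PiE N (\<lambda>v. {..<a v}) = ?S"
    proof (intro subset_antisym subsetI)
      fix H assume "H \<in> (\<lambda>\<phi>. (\<lambda>v. (v, \<phi> v)) ` N) ` PiE N (\<lambda>v. {..<a v})"
      then obtain \<phi> where \<phi>: "\<phi> \<in> PiE N (\<lambda>v. {..<a v})" "H = (\<lambda>v. (v, \<phi> v)) ` N"
        by blast
      have "H \<subseteq> (SIGMA v:U. {..<a v})"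
        using \<phi> assms(2) by (auto dest!: PiE_mem)
      moreover have "inj_on fst H" "fst ` H = N"
        unfolding \<phi>(2) by (auto simp: inj_on_def image_image)
      ultimately show "H \<in> ?S"
        using fin finN by (simp add: image_mset_eq_mset_set_iff)
    next
      fix H assume "H \<in> ?S"
      then have H: "H \<subseteq> (SIGMA v:U. {..<a v})" and "inj_on fst H" "fst ` H = N"
        using image_mset_eq_mset_set_iff[OF fin finN, of H fst] by simp_all
      define \<phi> where "\<phi> = restrict (\<lambda>v. snd (inv_into H fst v)) N"
      have inH: "inv_into H fst v \<in> H" and fst_inv: "fst (inv_into H fst v) = v" if "v \<in> N" for v
        using that \<open>fst ` H = N\<close> by (auto intro: inv_into_into f_inv_into_f)
      have pair: "(v, \<phi> v) = inv_into H fst v" if "v \<in> N" for v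
        using fst_inv[OF that] that by (simp add: \<phi>_def prod_eq_iff)
      have "(\<lambda>v. (v, \<phi> v)) ` N = inv_into H fst ` N"
        using pair by (auto simp: image_iff)
      also have "\<dots> = H"
        unfolding \<open>fst ` H = N\<close>[symmetric] using \<open>inj_on fst H\<close> by simp
      finally have "H = (\<lambda>v. (v, \<phi> v)) ` N" ..
      moreover have "\<phi> \<in> PiE N (\<lambda>v. {..<a v})"
      proof (rule PiE_I)
        fix v assume "v \<in> N"
        then have "(v, \<phi> v) \<in> H"
          using inH pair by simp
        then show "\<phi> v \<in> {..<a v}"
          using H by blast
      qed (simp add: \<phi>_def)
      ultimately show "H \<in> (\<lambda>\<phi>. (\<lambda>v. (v, \<phi> v)) ` N) ` PiE N (\<lambda>v. {..<a v})"
        by blast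
    qed
  qed
  from bij_betw_same_card[OF this] show ?thesis
    using finN by (simp add: card_PiE)
qed

lemma half_edge_subsets:
  fixes a :: "nat \<Rightarrow> nat"
  assumes "finite U"
  shows "finite {H. H \<subseteq> (SIGMA v:U. {..<a v}) \<and> card H = m}"
    and "card {H. H \<subseteq> (SIGMA v:U. {..<a v}) \<and> card H = m} = (\<Sum>v\<in>U. a v) choose m"
    and "m \<le> (\<Sum>v\<in>U. a v) \<Longrightarrow> {H. H \<subseteq> (SIGMA v:U. {..<a v}) \<and> card H = m} \<noteq> {}"
proof -
  have fin: "finite (SIGMA v:U. {..<a v})"
    using assms by auto
  show "finite {H. H \<subseteq> (SIGMA v:U. {..<a v}) \<and> card H = m}"
    using fin by (auto intro: finite_subset[OF _ finite_Pow_iff[THEN iffD2, OF fin]])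
  show card: "card {H. H \<subseteq> (SIGMA v:U. {..<a v}) \<and> card H = m} = (\<Sum>v\<in>U. a v) choose m"
    using n_subsets[OF fin] assms by simp
  show "{H. H \<subseteq> (SIGMA v:U. {..<a v}) \<and> card H = m} \<noteq> {}" if "m \<le> (\<Sum>v\<in>U. a v)"
    using card that by (metis card.empty binomial_eq_0_iff not_le)
qed

text \<open>
  The bound on \<open>m\<close> is what makes the uniform law in \<open>draw_half_edges\<close> one on a non-empty set; nothing
  can be said of its support otherwise.
\<close>

lemma draw_half_edges_support:
  assumes "finite U" "m \<le> (\<Sum>v\<in>U. a v)" "D \<in> set_pmf (draw_half_edges U a m)"
  shows "set_mset D \<subseteq> U" "size D = m" "count D v \<le> a v"
proof -
  obtain H where H: "H \<subseteq> (SIGMA v:U. {..<a v})" "card H = m"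
    and D: "D = image_mset fst (mset_set H)"
    using assms(3) half_edge_subsets(1,3)[OF assms(1)] assms(2)
    unfolding draw_half_edges_def by auto
  have finH: "finite H"
    using H(1) assms(1) by (auto intro: finite_subset)
  show "set_mset D \<subseteq> U" "size D = m"
    using H finH D by auto
  have "count D v = card {x \<in> H. v = fst x}"
    unfolding D count_image_mset' using finH by (simp add: Collect_conj_eq Int_commute)
  also have "{x \<in> H. v = fst x} \<subseteq> Pair v ` {..<a v}"
    using H(1) by auto
  then have "card {x \<in> H. v = fst x} \<le> card (Pair v ` {..<a v})"
    by (intro card_mono) auto
  also have "\<dots> = a v"
    by (simp add: card_image inj_on_def)
  finally show "count D v \<le> a v" .
qed

lemma pmf_draw_half_edges_mset_set:
  assumes "finite U" "N \<subseteq> U" "card N \<le> (\<Sum>v\<in>U. a v)"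
  shows "pmf (draw_half_edges U a (card N)) (mset_set N)
       = (\<Prod>v\<in>N. real (a v)) / real ((\<Sum>v\<in>U. a v) choose card N)"
proof -
  let ?B = "SIGMA v:U. {..<a v}" and ?f = "\<lambda>H::(nat\<times>nat) set. image_mset fst (mset_set H)"
  have "card H = card N" if "?f H = mset_set N" for H
    using arg_cong[OF that, of size] by simp
  then have "{H. H \<subseteq> ?B \<and> card H = card N} \<inter> ?f -` {mset_set N}
      = {H. H \<subseteq> ?B \<and> ?f H = mset_set N}"
    by auto
  then have "measure (measure_pmf (pmf_of_set {H. H \<subseteq> ?B \<and> card H = card N})) (?f -` {mset_set N})
      = real (card {H. H \<subseteq> ?B \<and> ?f H = mset_set N}) / real (card {H. H \<subseteq> ?B \<and> card H = card N})"
    by (simp add: measure_pmf_of_set[OF half_edge_subsets(3,1)[OF assms(1)]] assms)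
  then show ?thesis
    unfolding draw_half_edges_def pmf_map
    using half_edge_subsets(2)[OF assms(1), of a "card N"] card_half_edge_choices[OF assms(1,2), of a]
    by simp
qed

section \<open>Choosing the match\<close>

lemma choose_match_support:
  assumes "local_matching_criterion n \<Phi>" "finite N" "N \<noteq> {}" "card N \<le> n"
    and "\<And>v. v \<in> N \<Longrightarrow> 0 < a v"
  shows "set_pmf (choose_match \<Phi> a N) \<subseteq> N"
proof
  fix j assume "j \<in> set_pmf (choose_match \<Phi> a N)"
  then obtain \<sigma> where \<sigma>: "\<sigma> permutes {..<card N}"
    and j: "j = permute_list \<sigma> (sorted_list_of_set N)
      ! (\<Phi> (map a (permute_list \<sigma> (sorted_list_of_set N))) - 1)"
    unfolding choose_match_def Let_def set_bind_pmf
    by (subst (asm) set_pmf_of_set) (auto simp: finite_permutations intro: permutes_id)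
  define xs where "xs = permute_list \<sigma> (sorted_list_of_set N)"
  have xs: "length xs = card N" "set xs = N"
    using \<sigma> assms(2) by (simp_all add: xs_def set_permute_list)
  moreover have "0 < card N"
    using assms(2,3) by (simp add: card_gt_0_iff)
  ultimately have "\<Phi> (map a xs) \<in> {1..card N}"
    using assms(1,4,5) unfolding local_matching_criterion_def
    by (metis One_nat_def Suc_leI imageE length_map set_map)
  then have "\<Phi> (map a xs) - 1 < length xs"
    using xs by auto
  then show "j \<in> N"
    using j xs by (metis nth_mem xs_def)
qed

text \<open>
  This lets the availabilities of the joint construction be exchanged for the degrees in the explored
  graph, with which they coincide only on the undetermined nodes.
\<close>

lemma choose_match_cong:
  assumes "finite N" "\<And>v. v \<in> N \<Longrightarrow> a v = b v"
  shows "choose_match \<Phi> a N = choose_match \<Phi> b N"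
  unfolding choose_match_def Let_def
proof (rule bind_pmf_cong[OF refl])
  fix \<sigma> assume "\<sigma> \<in> set_pmf (pmf_of_set {\<sigma>. \<sigma> permutes {..<card N}})"
  then have "\<sigma> permutes {..<card N}"
    by (subst (asm) set_pmf_of_set) (auto simp: finite_permutations intro: permutes_id)
  then have "set (permute_list \<sigma> (sorted_list_of_set N)) = N"
    using assms(1) by (simp add: set_permute_list)
  then have "map a (permute_list \<sigma> (sorted_list_of_set N)) = map b (permute_list \<sigma> (sorted_list_of_set N))"
    using assms(2) by simp
  then show "return_pmf (permute_list \<sigma> (sorted_list_of_set N) !
           (\<Phi> (map a (permute_list \<sigma> (sorted_list_of_set N))) - 1)) =
         return_pmf (permute_list \<sigma> (sorted_list_of_set N) !
           (\<Phi> (map b (permute_list \<sigma> (sorted_list_of_set N))) - 1))"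
    by (simp only:)
qed

section \<open>The probability of completing the configuration model to a given simple graph\<close>

text \<open>
  The probability that a uniform pairing of the half-edges of the nodes \<open>fst x\<close> and \<open>snd x\<close>, with the
  degrees of \<open>F\<close>, yields the simple graph \<open>F\<close>: of the \<open>fact (card F)\<close> pairings, those yielding \<open>F\<close> are
  obtained by distributing, at each node, its half-edges over its neighbours.
\<close>

definition configuration_prob :: "(nat \<times> nat) set \<Rightarrow> expl_state \<Rightarrow> real" where
  "configuration_prob F x =
     (\<Prod>v\<in>fst x. fact (deg_plus F v)) * (\<Prod>v\<in>snd x. fact (deg_minus F v)) / fact (card F)"

lemma configuration_prob_pos: "0 < configuration_prob F x"
  unfolding configuration_prob_def by (intro divide_pos_pos mult_pos_pos prod_pos) auto

lemma deg_minus_eq_deg_plus_converse: "deg_minus F = deg_plus (F\<inverse>)"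
  by (simp add: deg_minus_def deg_plus_def fun_eq_iff)

lemma sum_deg_plus:
  assumes "F \<subseteq> A \<times> B" "finite A" "finite B"
  shows "(\<Sum>v\<in>A. deg_plus F v) = card F"
proof -
  have "F = (SIGMA v:A. F `` {v})"
    using assms(1) by auto
  moreover have "finite (F `` {v})" for v
    using assms by (intro finite_subset[of "F `` {v}" B]) auto
  ultimately have "card F = (\<Sum>v\<in>A. card (F `` {v}))"
    using assms(2) by (metis card_SigmaI)
  then show ?thesis
    by (simp add: deg_plus_def)
qed

lemma sum_deg_minus:
  assumes "F \<subseteq> A \<times> B" "finite A" "finite B"
  shows "(\<Sum>v\<in>B. deg_minus F v) = card F"
  using sum_deg_plus[of "F\<inverse>" B A] assms
  by (auto simp: deg_minus_eq_deg_plus_converse card_inverse)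

lemma deg_plus_remove:
  assumes "F \<subseteq> A \<times> B" "finite B" "v \<in> A - {J}"
  shows "deg_plus F v = deg_plus (F \<inter> ((A - {J}) \<times> (B - {J'}))) v + (if v \<in> F\<inverse> `` {J'} - {J} then 1 else 0)"
proof -
  define N where "N = (F \<inter> ((A - {J}) \<times> (B - {J'}))) `` {v}"
  have N: "finite N" "J' \<notin> N"
    using assms unfolding N_def by (auto intro: finite_subset[of _ B])
  have "F `` {v} = N \<union> (if v \<in> F\<inverse> `` {J'} - {J} then {J'} else {})"
    using assms unfolding N_def by auto
  then have "card (F `` {v}) = card N + (if v \<in> F\<inverse> `` {J'} - {J} then 1 else 0)"
    using N by (cases "v \<in> F\<inverse> `` {J'} - {J}") simp_all
  then show ?thesis
    by (simp only: deg_plus_def N_def)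
qed

lemma deg_minus_remove:
  assumes "F \<subseteq> A \<times> B" "finite A" "v \<in> B - {J'}"
  shows "deg_minus F v = deg_minus (F \<inter> ((A - {J}) \<times> (B - {J'}))) v + (if v \<in> F `` {J} then 1 else 0)"
proof -
  have "F\<inverse> \<subseteq> B \<times> A"
    and inter: "F\<inverse> \<inter> ((B - {J'}) \<times> (A - {J})) = (F \<inter> ((A - {J}) \<times> (B - {J'})))\<inverse>"
    using assms(1) by auto
  moreover have "v \<in> (F\<inverse>)\<inverse> `` {J} - {J'} \<longleftrightarrow> v \<in> F `` {J}"
    using assms(3) by simp
  ultimately show ?thesis
    using deg_plus_remove[OF \<open>F\<inverse> \<subseteq> B \<times> A\<close> assms(2,3), of J] inter
    by (simp only: deg_minus_eq_deg_plus_converse)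
qed

lemma card_remove:
  assumes "F \<subseteq> A \<times> B" "finite A" "finite B"
  shows "card F = card (F `` {J}) + card (F\<inverse> `` {J'} - {J}) + card (F \<inter> ((A - {J}) \<times> (B - {J'})))"
proof -
  let ?N = "F `` {J}" and ?N' = "F\<inverse> `` {J'} - {J}" and ?F = "F \<inter> ((A - {J}) \<times> (B - {J'}))"
  have fin: "finite F" "finite ?N" "finite ?N'" "finite ?F"
    using assms finite_subset[of ?N B] finite_subset[of ?N' A] by (auto intro: finite_subset)
  have "F = (Pair J ` ?N \<union> (\<lambda>v. (v, J')) ` ?N') \<union> ?F"
    using assms(1) by auto
  also have "card \<dots> = card (Pair J ` ?N \<union> (\<lambda>v. (v, J')) ` ?N') + card ?F"
    using fin by (intro card_Un_disjoint) auto
  also have "card (Pair J ` ?N \<union> (\<lambda>v. (v, J')) ` ?N') = card (Pair J ` ?N) + card ((\<lambda>v. (v, J')) ` ?N')"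
    using fin by (intro card_Un_disjoint) auto
  finally show ?thesis
    by (simp add: card_image inj_on_def)
qed

text \<open>
  Each node of \<open>N\<close> loses one half-edge, which takes the leading factor from its factorial.
\<close>

lemma prod_fact_remove:
  fixes a b :: "'a \<Rightarrow> nat"
  assumes "finite A" "N \<subseteq> A" "\<And>v. v \<in> A \<Longrightarrow> a v = b v + (if v \<in> N then 1 else 0)"
  shows "(\<Prod>v\<in>A. fact (a v) :: real) = (\<Prod>v\<in>N. real (a v)) * (\<Prod>v\<in>A. fact (b v))"
proof -
  have "(\<Prod>v\<in>A. fact (a v) :: real) = (\<Prod>v\<in>A. (if v \<in> N then real (a v) else 1) * fact (b v))"
    using assms(3) by (intro prod.cong) (auto simp: fact_Suc)
  also have "\<dots> = (\<Prod>v\<in>A. if v \<in> N then real (a v) else 1) * (\<Prod>v\<in>A. fact (b v))"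
    by (rule prod.distrib)
  also have "(\<Prod>v\<in>A. if v \<in> N then real (a v) else 1) = (\<Prod>v\<in>N. real (a v))"
    using assms(1,2) by (simp add: prod.If_cases Int_absorb1)
  finally show ?thesis .
qed

text \<open>
  The first two factors are the probabilities that the draw of \<open>J\<close> reaches each of its neighbours
  once, and that the remaining half-edges of \<open>J'\<close> reach its other neighbours once. All factorials
  telescope: the removal of an edge takes the degree from the factorial of its undetermined end,
  \<open>fact (card N)\<close> and \<open>fact (card N')\<close> cancel against those of the binomial coefficients, and the
  degree of \<open>J'\<close>, which exceeds \<open>card N'\<close> by one because of \<open>J\<close>, supplies the factor of \<open>J'\<close> in the
  product over \<open>N\<close>.
\<close>

lemma configuration_prob_step:
  assumes F: "F \<subseteq> A \<times> B" and fin: "finite A" "finite B"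
    and edge: "(J, J') \<in> F"
  defines "N \<equiv> F `` {J}" and "N' \<equiv> F\<inverse> `` {J'} - {J}"
  shows "configuration_prob F (A, B)
       = (\<Prod>v\<in>N. real (deg_minus F v)) / real (card F choose card N)
       * ((\<Prod>v\<in>N'. real (deg_plus F v)) / real ((card F - card N) choose card N'))
       * configuration_prob (F \<inter> ((A - {J}) \<times> (B - {J'}))) (A - {J}, B - {J'})"
proof -
  let ?F = "F \<inter> ((A - {J}) \<times> (B - {J'}))"
  have mem: "J \<in> A" "J' \<in> B" "J' \<in> N" "N \<subseteq> B" "N' \<subseteq> A - {J}"
    using F edge by (auto simp: N_def N'_def)
  have finN: "finite N" "finite N'"
    using mem fin finite_subset by blast+
  have cF: "card F = card N + card N' + card ?F"
    unfolding N_def N'_def by (rule card_remove[OF F fin])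
  have dJ: "deg_plus F J = card N"
    by (simp add: deg_plus_def N_def)
  have "F\<inverse> `` {J'} = insert J N'"
    using edge by (auto simp: N'_def)
  moreover have "J \<notin> N'"
    by (simp add: N'_def)
  ultimately have dJ': "deg_minus F J' = Suc (card N')"
    using finN by (simp add: deg_minus_def)
  have "(\<Prod>v\<in>A. fact (deg_plus F v) :: real) = fact (card N) * (\<Prod>v\<in>A - {J}. fact (deg_plus F v))"
    using fin mem dJ by (simp add: prod.remove)
  also have "(\<Prod>v\<in>A - {J}. fact (deg_plus F v) :: real)
      = (\<Prod>v\<in>N'. real (deg_plus F v)) * (\<Prod>v\<in>A - {J}. fact (deg_plus ?F v))"
    using fin mem deg_plus_remove[OF F fin(2)] by (intro prod_fact_remove) (auto simp: N'_def)
  finally have plus: "(\<Prod>v\<in>A. fact (deg_plus F v) :: real)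
      = fact (card N) * ((\<Prod>v\<in>N'. real (deg_plus F v)) * (\<Prod>v\<in>A - {J}. fact (deg_plus ?F v)))" .
  have "(\<Prod>v\<in>B. fact (deg_minus F v) :: real)
      = real (deg_minus F J') * fact (card N') * (\<Prod>v\<in>B - {J'}. fact (deg_minus F v))"
    using fin mem dJ' by (simp add: prod.remove fact_Suc)
  also have "(\<Prod>v\<in>B - {J'}. fact (deg_minus F v) :: real)
      = (\<Prod>v\<in>N - {J'}. real (deg_minus F v)) * (\<Prod>v\<in>B - {J'}. fact (deg_minus ?F v))"
    using fin mem deg_minus_remove[OF F fin(1)] by (intro prod_fact_remove) (auto simp: N_def)
  also have "real (deg_minus F J') * fact (card N') * \<dots>
      = fact (card N') * (real (deg_minus F J') * (\<Prod>v\<in>N - {J'}. real (deg_minus F v)))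
        * (\<Prod>v\<in>B - {J'}. fact (deg_minus ?F v))"
    by simp
  also have "real (deg_minus F J') * (\<Prod>v\<in>N - {J'}. real (deg_minus F v))
      = (\<Prod>v\<in>N. real (deg_minus F v))"
    using finN mem by (simp add: prod.remove[of N J'])
  finally have minus: "(\<Prod>v\<in>B. fact (deg_minus F v) :: real)
      = fact (card N') * (\<Prod>v\<in>N. real (deg_minus F v)) * (\<Prod>v\<in>B - {J'}. fact (deg_minus ?F v))" .
  have bin1: "real (card F choose card N) = fact (card F) / (fact (card N) * fact (card F - card N))"
    using cF by (intro binomial_fact) simp
  have bin2: "real ((card F - card N) choose card N')
      = fact (card F - card N) / (fact (card N') * fact (card ?F))"
    using cF by (subst binomial_fact) simp_all
  show ?thesis
    unfolding configuration_prob_def fst_conv snd_conv plus minus bin1 bin2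
    by (simp add: field_simps)
qed

lemma configuration_prob_isolated:
  assumes "F \<subseteq> A \<times> B" "finite A" "J \<in> A" "F `` {J} = {}"
  shows "configuration_prob F (A - {J}, B) = configuration_prob F (A, B)"
proof -
  have "deg_plus F J = 0"
    using assms(4) by (simp add: deg_plus_def)
  then show ?thesis
    using assms(2,3) by (simp add: configuration_prob_def prod.remove[of A J])
qed

definition completion_prob :: "(nat \<times> nat) set \<Rightarrow> expl_state \<Rightarrow> real" where
  "completion_prob E x = configuration_prob (induced E x) x"

section \<open>Settled edges of the joint construction\<close>

definition undetermined :: "joint_state \<Rightarrow> expl_state" where
  "undetermined s = (U_plus s, U_minus s)"

definition reveal :: "joint_state \<Rightarrow> nat \<Rightarrow> nat multiset \<Rightarrow> nat \<Rightarrow> nat multiset \<Rightarrow> joint_state" where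
  "reveal s J D J' D' =
     \<lparr>U_plus = U_plus s - {J},
      U_minus = U_minus s - {J'},
      avail_plus = (\<lambda>v. avail_plus s v - count D' v),
      avail_minus = (\<lambda>v. avail_minus s v - count D v),
      graph = graph s + image_mset (\<lambda>v. (J, v)) D + image_mset (\<lambda>v. (v, J')) D'\<rparr>"

lemma reveal_simps [simp]:
  "U_plus (reveal s J D J' D') = U_plus s - {J}"
  "U_minus (reveal s J D J' D') = U_minus s - {J'}"
  "avail_plus (reveal s J D J' D') v = avail_plus s v - count D' v"
  "avail_minus (reveal s J D J' D') v = avail_minus s v - count D v"
  by (simp_all add: reveal_def)

lemma count_image_mset_Pair:
  "count (image_mset (\<lambda>v. (J, v)) D) e = (if fst e = J then count D (snd e) else 0)"
  by (induction D) (auto simp: prod_eq_iff)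

lemma count_image_mset_Pair':
  "count (image_mset (\<lambda>v. (v, J')) D) e = (if snd e = J' then count D (fst e) else 0)"
  by (induction D) (auto simp: prod_eq_iff)

lemma count_graph_reveal:
  "count (graph (reveal s J D J' D')) (i, j) =
     count (graph s) (i, j) + (if i = J then count D j else 0) + (if j = J' then count D' i else 0)"
  by (simp add: reveal_def count_image_mset_Pair count_image_mset_Pair')

text \<open>
  An invariant of every step, whatever the graph obtained: as both sides have the same total
  availability, the half-edges needed by the two draws of a step always exist, so that neither is a
  uniform law on the empty set. The bound by \<open>n\<close> keeps the number of neighbours in the range where
  \<open>\<Phi>\<close> is constrained.
\<close>

definition balanced :: "nat \<Rightarrow> joint_state \<Rightarrow> bool" where
  "balanced n s \<longleftrightarrow> U_plus s \<subseteq> {1..n} \<and> U_minus s \<subseteq> {1..n} \<and>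
     (\<Sum>v\<in>U_plus s. avail_plus s v) = (\<Sum>v\<in>U_minus s. avail_minus s v)"

lemma balanced_finite:
  assumes "balanced n s"
  shows "finite (U_plus s)" "finite (U_minus s)"
  using assms finite_subset by (auto simp: balanced_def)

lemma size_eq_sum_count:
  assumes "finite U" "set_mset D \<subseteq> U"
  shows "size D = (\<Sum>v\<in>U. count D v)"
  unfolding size_multiset_overloaded_eq
  using assms by (intro sum.mono_neutral_left) (auto simp: count_eq_zero_iff)

text \<open>
  The draw of \<open>J\<close> fits since the totals agree. After it, the total left on the minus side equals the
  one left on the plus side without \<open>J\<close>, and the remaining half-edges of \<open>J'\<close> are among the former,
  so the second draw fits too.
\<close>

lemma reveal_draws:
  assumes crit: "local_matching_criterion n \<Phi>" and s: "balanced n s"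
    and J: "J \<in> U_plus s" "avail_plus s J \<noteq> 0"
    and D: "D \<in> set_pmf (draw_half_edges (U_minus s) (avail_minus s) (avail_plus s J))"
    and J': "J' \<in> set_pmf (choose_match \<Phi> (avail_minus s) (set_mset D))"
    and D': "D' \<in> set_pmf (draw_half_edges (U_plus s - {J}) (avail_plus s) (avail_minus s J' - count D J'))"
  shows "set_mset D \<subseteq> U_minus s" "J' \<in># D" "set_mset D' \<subseteq> U_plus s - {J}"
    and "balanced n (reveal s J D J' D')"
proof -
  note fin = balanced_finite[OF s]
  let ?ap = "avail_plus s" and ?am = "avail_minus s"
  have total: "(\<Sum>v\<in>U_plus s. ?ap v) = ?ap J + (\<Sum>v\<in>U_plus s - {J}. ?ap v)"
    using fin J by (simp add: sum.remove)
  have le: "?ap J \<le> (\<Sum>v\<in>U_minus s. ?am v)"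
    using total s by (simp add: balanced_def)
  note Dfacts = draw_half_edges_support[OF fin(2) le D]
  show DU: "set_mset D \<subseteq> U_minus s"
    by (rule Dfacts(1))
  have "card (set_mset D) \<le> n"
    using DU s card_mono[of "{1..n}" "set_mset D"] by (auto simp: balanced_def)
  moreover have "set_mset D \<noteq> {}"
    using Dfacts(2) J(2) by auto
  moreover have "0 < ?am v" if "v \<in># D" for v
    using Dfacts(3)[of v] that by (metis count_greater_zero_iff less_le_trans)
  ultimately have "set_pmf (choose_match \<Phi> ?am (set_mset D)) \<subseteq> set_mset D"
    by (intro choose_match_support[OF crit]) auto
  then show J'D: "J' \<in># D"
    using J' by blast
  then have J'U: "J' \<in> U_minus s"
    using DU by blast
  have totalm: "(\<Sum>v\<in>U_minus s. ?am v) = ?am J' + (\<Sum>v\<in>U_minus s - {J'}. ?am v)"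
    using fin J'U by (simp add: sum.remove)
  have sizeD: "?ap J = count D J' + (\<Sum>v\<in>U_minus s - {J'}. count D v)"
    using size_eq_sum_count[OF fin(2) DU] Dfacts(2) fin J'U by (simp add: sum.remove)
  have leD: "(\<Sum>v\<in>U_minus s - {J'}. count D v) \<le> (\<Sum>v\<in>U_minus s - {J'}. ?am v)"
    using Dfacts(3) by (intro sum_mono) auto
  have bal: "(\<Sum>v\<in>U_plus s. ?ap v) = (\<Sum>v\<in>U_minus s. ?am v)"
    using s by (simp add: balanced_def)
  have "?am J' - count D J' \<le> (\<Sum>v\<in>U_plus s - {J}. ?ap v)"
    using total totalm sizeD leD bal Dfacts(3)[of J'] by linarith
  note D'facts = draw_half_edges_support[OF _ this D']
  show D'U: "set_mset D' \<subseteq> U_plus s - {J}"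
    using D'facts(1) fin by blast
  have "(\<Sum>v\<in>U_plus s - {J}. ?ap v - count D' v) = (\<Sum>v\<in>U_plus s - {J}. ?ap v) - size D'"
    using D'facts(3) fin D'U by (simp add: sum_subtractf_nat size_eq_sum_count[of "U_plus s - {J}"])
  moreover have "(\<Sum>v\<in>U_minus s - {J'}. ?am v - count D v)
      = (\<Sum>v\<in>U_minus s - {J'}. ?am v) - (\<Sum>v\<in>U_minus s - {J'}. count D v)"
    using Dfacts(3) by (simp add: sum_subtractf_nat)
  moreover have "size D' = ?am J' - count D J'"
    using D'facts(2) fin by blast
  ultimately have "(\<Sum>v\<in>U_plus s - {J}. ?ap v - count D' v) = (\<Sum>v\<in>U_minus s - {J'}. ?am v - count D v)"
    using total totalm sizeD leD bal Dfacts(3)[of J'] by linarith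
  then show "balanced n (reveal s J D J' D')"
    using s by (auto simp: balanced_def)
qed

definition joint_step_at :: "(nat list \<Rightarrow> nat) \<Rightarrow> joint_state \<Rightarrow> nat \<Rightarrow> joint_state pmf" where
  "joint_step_at \<Phi> s J =
     (if avail_plus s J = 0 then return_pmf (s\<lparr>U_plus := U_plus s - {J}\<rparr>)
      else do {
       D \<leftarrow> draw_half_edges (U_minus s) (avail_minus s) (avail_plus s J);
       J' \<leftarrow> choose_match \<Phi> (avail_minus s) (set_mset D);
       D' \<leftarrow> draw_half_edges (U_plus s - {J}) (avail_plus s) (avail_minus s J' - count D J');
       return_pmf (reveal s J D J' D')
     })"

lemma joint_step_eq: "joint_step \<Phi> s = bind_pmf (pmf_of_set (U_plus s)) (joint_step_at \<Phi> s)"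
  unfolding joint_step_def joint_step_at_def reveal_def ..

lemma joint_step_cases:
  assumes crit: "local_matching_criterion n \<Phi>" and s: "balanced n s" and ne: "U_plus s \<noteq> {}"
    and s': "s' \<in> set_pmf (joint_step \<Phi> s)"
  obtains (isolated) J where "J \<in> U_plus s" "avail_plus s J = 0" "s' = s\<lparr>U_plus := U_plus s - {J}\<rparr>"
    | (matched) J D J' D' where "J \<in> U_plus s" "avail_plus s J \<noteq> 0"
        "set_mset D \<subseteq> U_minus s" "J' \<in># D" "set_mset D' \<subseteq> U_plus s - {J}"
        "balanced n (reveal s J D J' D')" "s' = reveal s J D J' D'"
proof -
  have "s' \<in> (\<Union>J\<in>U_plus s. set_pmf (joint_step_at \<Phi> s J))"
    using s' by (simp only: joint_step_eq set_bind_pmf set_pmf_of_set[OF ne balanced_finite(1)[OF s]])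
  then obtain J where J: "J \<in> U_plus s" and *: "s' \<in> set_pmf (joint_step_at \<Phi> s J)"
    by (rule UN_E)
  show thesis
  proof (cases "avail_plus s J = 0")
    case True
    then show thesis
      using isolated[OF J] * by (simp add: joint_step_at_def)
  next
    case False
    then obtain D J' D' where draws:
      "D \<in> set_pmf (draw_half_edges (U_minus s) (avail_minus s) (avail_plus s J))"
      "J' \<in> set_pmf (choose_match \<Phi> (avail_minus s) (set_mset D))"
      "D' \<in> set_pmf (draw_half_edges (U_plus s - {J}) (avail_plus s) (avail_minus s J' - count D J'))"
      and s'_eq: "s' = reveal s J D J' D'"
      using * by (auto simp: joint_step_at_def)
    show thesis
      by (rule matched[OF J False reveal_draws[OF crit s J False draws] s'_eq])
  qed
qed

lemma balanced_isolated:
  assumes "balanced n s" "J \<in> U_plus s" "avail_plus s J = 0"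
  shows "balanced n (s\<lparr>U_plus := U_plus s - {J}\<rparr>)"
  using assms balanced_finite[OF assms(1)] by (auto simp: balanced_def sum.remove)

text \<open>
  A step only adds edges at \<open>J\<close> or \<open>J'\<close> whose other end was undetermined, so an edge with an end
  already removed keeps its multiplicity.
\<close>

lemma joint_step_settles:
  assumes crit: "local_matching_criterion n \<Phi>" and s: "balanced n s" and ne: "U_plus s \<noteq> {}"
    and s': "s' \<in> set_pmf (joint_step \<Phi> s)"
  shows "balanced n s'" "card (U_plus s) = Suc (card (U_plus s'))"
    and "U_plus s' \<times> U_minus s' \<subseteq> U_plus s \<times> U_minus s"
    and "e \<notin> U_plus s \<times> U_minus s \<Longrightarrow> count (graph s') e = count (graph s) e"
proof -
  have "balanced n s' \<and> card (U_plus s) = Suc (card (U_plus s')) \<and>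
    U_plus s' \<times> U_minus s' \<subseteq> U_plus s \<times> U_minus s \<and>
    (e \<notin> U_plus s \<times> U_minus s \<longrightarrow> count (graph s') e = count (graph s) e)"
    using crit s ne s'
  proof (cases rule: joint_step_cases)
    case (isolated J)
    then show ?thesis
      using balanced_isolated[OF s] card.remove[OF balanced_finite(1)[OF s]] by auto
  next
    case (matched J D J' D')
    have "count (graph s') e = count (graph s) e" if "e \<notin> U_plus s \<times> U_minus s"
    proof (cases e)
      case (Pair i j)
      have "J' \<in> U_minus s"
        using matched by blast
      then have "i = J \<Longrightarrow> j \<notin># D" "j = J' \<Longrightarrow> i \<notin># D'"
        using that matched Pair by blast+
      then show ?thesis
        using matched(7) Pair by (simp add: count_graph_reveal count_eq_zero_iff)
    qed
    then show ?thesis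
      using matched card.remove[OF balanced_finite(1)[OF s]] by auto
  qed
  then show "balanced n s'" "card (U_plus s) = Suc (card (U_plus s'))"
    "U_plus s' \<times> U_minus s' \<subseteq> U_plus s \<times> U_minus s"
    "e \<notin> U_plus s \<times> U_minus s \<Longrightarrow> count (graph s') e = count (graph s) e"
    by blast+
qed

lemma trajectory_settles:
  assumes "local_matching_criterion n \<Phi>" "balanced n s" "card (U_plus s) = m"
    and "\<omega> \<in> set_pmf (trajectory (joint_step \<Phi>) m s)" "e \<notin> U_plus s \<times> U_minus s"
  shows "count (graph (\<omega> ! m)) e = count (graph s) e"
  using assms(2-)
proof (induction m arbitrary: s \<omega>)
  case 0
  then show ?case by simp
next
  case (Suc m)
  obtain s' \<omega>' where s': "s' \<in> set_pmf (joint_step \<Phi> s)"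
    and \<omega>': "\<omega>' \<in> set_pmf (trajectory (joint_step \<Phi>) m s')" "\<omega> = s # \<omega>'"
    using Suc.prems(3) by auto
  have ne: "U_plus s \<noteq> {}"
    using Suc.prems(2) by auto
  note step = joint_step_settles[OF assms(1) Suc.prems(1) ne s']
  have "count (graph (\<omega>' ! m)) e = count (graph s') e"
    using Suc.IH[OF step(1) _ \<omega>'(1)] step(2,3) Suc.prems(2,4) by auto
  then show ?case
    using \<omega>'(2) step(4)[OF Suc.prems(4)] by simp
qed

section \<open>States that can still lead to the prescribed graph\<close>

text \<open>
  The multiplicities of the settled edges, those with a removed end, are final by
  \<open>trajectory_settles\<close>, so this is necessary for a completion to \<open>E\<close>.
\<close>

definition agrees :: "(nat \<times> nat) set \<Rightarrow> joint_state \<Rightarrow> bool" where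
  "agrees E s \<longleftrightarrow> (\<forall>e. e \<notin> U_plus s \<times> U_minus s \<longrightarrow> count (graph s) e = (if e \<in> E then 1 else 0))"

text \<open>
  The states of the joint construction that can still be completed to \<open>E\<close>, described so that the
  remaining graph and the availabilities are functions of the undetermined sets.
\<close>

definition compatible :: "(nat \<times> nat) set \<Rightarrow> joint_state \<Rightarrow> bool" where
  "compatible E s \<longleftrightarrow> agrees E s \<and>
     (\<forall>e \<in> U_plus s \<times> U_minus s. count (graph s) e = 0) \<and>
     (\<forall>v \<in> U_plus s. avail_plus s v = deg_plus (induced E (undetermined s)) v) \<and>
     (\<forall>v \<in> U_minus s. avail_minus s v = deg_minus (induced E (undetermined s)) v)"

lemma induced_isolated:
  "induced E (A, B) `` {J} = {} \<Longrightarrow> induced E (A - {J}, B) = induced E (A, B)"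
  by (auto simp: induced_def)

lemma induced_remove:
  "induced E (A - {J}, B - {J'}) = induced E (A, B) \<inter> ((A - {J}) \<times> (B - {J'}))"
  by (auto simp: induced_def)

lemma compatible_count_graph:
  assumes "compatible E s"
  shows "count (graph s) (i, j) = (if (i, j) \<in> E \<and> \<not> (i \<in> U_plus s \<and> j \<in> U_minus s) then 1 else 0)"
proof (cases "(i, j) \<in> U_plus s \<times> U_minus s")
  case True
  have "\<forall>e \<in> U_plus s \<times> U_minus s. count (graph s) e = 0"
    using assms unfolding compatible_def by (elim conjE)
  from bspec[OF this True] show ?thesis
    using True by simp
next
  case False
  have "\<forall>e. e \<notin> U_plus s \<times> U_minus s \<longrightarrow> count (graph s) e = (if e \<in> E then 1 else 0)"
    using assms unfolding compatible_def agrees_def by (elim conjE)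
  from this[rule_format, OF False] show ?thesis
    using False by simp
qed

lemma compatible_isolated:
  assumes s: "compatible E s" and J: "J \<in> U_plus s" and iso: "induced E (undetermined s) `` {J} = {}"
  shows "compatible E (s\<lparr>U_plus := U_plus s - {J}\<rparr>)" (is "compatible E ?s'")
proof -
  have ind: "induced E (undetermined ?s') = induced E (undetermined s)"
    using iso by (simp add: undetermined_def induced_isolated)
  have noE: "(J, j) \<notin> E" if "j \<in> U_minus s" for j
    using J iso that by (auto simp: induced_def undetermined_def)
  have "agrees E ?s'"
    unfolding agrees_def
  proof (intro allI impI)
    fix e assume "e \<notin> U_plus ?s' \<times> U_minus ?s'"
    then show "count (graph ?s') e = (if e \<in> E then 1 else 0)"
      using noE by (cases e) (auto simp: compatible_count_graph[OF s])
  qed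
  then show ?thesis
    using s unfolding compatible_def ind by simp
qed

text \<open>
  Every edge at \<open>J\<close> is settled by the step, and every edge between \<open>J\<close> and an undetermined node has
  been added by it, hence \<open>D\<close> is read off from \<open>E\<close>. The same holds for \<open>J'\<close>, whose edge to
  \<open>J\<close> belongs to \<open>D\<close> and not to \<open>D'\<close>.
\<close>

lemma reveal_agrees_imp:
  assumes s: "compatible E s" and fin: "finite (U_plus s)" "finite (U_minus s)"
    and J: "J \<in> U_plus s" and J': "J' \<in> U_minus s"
    and D: "set_mset D \<subseteq> U_minus s" and D': "set_mset D' \<subseteq> U_plus s - {J}"
    and ag: "agrees E (reveal s J D J' D')"
  defines "F \<equiv> induced E (undetermined s)"
  shows "D = mset_set (F `` {J})" and "D' = mset_set (F\<inverse> `` {J'} - {J})"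
proof -
  have finF: "finite (F `` {J})" "finite (F\<inverse> `` {J'} - {J})"
    using fin finite_subset[of "F `` {J}" "U_minus s"] finite_subset[of "F\<inverse> `` {J'} - {J}" "U_plus s"]
    by (auto simp: F_def induced_def undetermined_def)
  have ct: "count (graph (reveal s J D J' D')) (i, j) = (if (i, j) \<in> E then 1 else 0)"
    if "i = J \<or> j = J'" for i j
    using ag that by (auto simp: agrees_def)
  have zero: "count (graph s) (i, j) = 0" if "i \<in> U_plus s" "j \<in> U_minus s" for i j
    using s that by (auto simp: compatible_def)
  show "D = mset_set (F `` {J})"
  proof (rule multiset_eqI)
    fix j
    show "count D j = count (mset_set (F `` {J})) j"
    proof (cases "j \<in> U_minus s")
      case True
      have "count D' J = 0"
        using D' by (auto simp: count_eq_zero_iff)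
      then have "count D j = (if (J, j) \<in> E then 1 else 0)"
        using ct[of J j] zero[OF J True] by (simp add: count_graph_reveal split: if_splits)
      then show ?thesis
        using finF True J by (auto simp: F_def induced_def undetermined_def count_mset_set')
    next
      case False
      then have "count D j = 0"
        using D by (auto simp: count_eq_zero_iff)
      then show ?thesis
        using finF False by (auto simp: F_def induced_def undetermined_def count_mset_set')
    qed
  qed
  show "D' = mset_set (F\<inverse> `` {J'} - {J})"
  proof (rule multiset_eqI)
    fix i
    show "count D' i = count (mset_set (F\<inverse> `` {J'} - {J})) i"
    proof (cases "i \<in> U_plus s - {J}")
      case True
      then have "count D' i = (if (i, J') \<in> E then 1 else 0)"
        using ct[of i J'] zero[of i J'] J' by (simp add: count_graph_reveal)
      then show ?thesis
        using finF True J' by (auto simp: F_def induced_def undetermined_def count_mset_set')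
    next
      case False
      then have "count D' i = 0"
        using D' by (auto simp: count_eq_zero_iff)
      then show ?thesis
        using finF False by (auto simp: F_def induced_def undetermined_def count_mset_set')
    qed
  qed
qed

lemma compatible_reveal:
  assumes s: "compatible E s" and fin: "finite (U_plus s)" "finite (U_minus s)"
  defines "F \<equiv> induced E (undetermined s)"
  assumes edge: "(J, J') \<in> F"
  shows "compatible E (reveal s J (mset_set (F `` {J})) J' (mset_set (F\<inverse> `` {J'} - {J})))"
    (is "compatible E ?s'")
proof -
  have sub: "F \<subseteq> U_plus s \<times> U_minus s"
    by (auto simp: F_def induced_def undetermined_def)
  have JJ': "J \<in> U_plus s" "J' \<in> U_minus s"
    using edge sub by auto
  have finF: "finite (F `` {J})" "finite (F\<inverse> `` {J'} - {J})"
    using fin sub finite_subset[of "F `` {J}" "U_minus s"] finite_subset[of "F\<inverse> `` {J'} - {J}" "U_plus s"]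
    by auto
  have ind: "induced E (undetermined ?s') = F \<inter> ((U_plus s - {J}) \<times> (U_minus s - {J'}))"
    by (auto simp: F_def undetermined_def induced_def)
  have inF: "(i, j) \<in> F \<longleftrightarrow> (i, j) \<in> E \<and> i \<in> U_plus s \<and> j \<in> U_minus s" for i j
    by (auto simp: F_def undetermined_def induced_def)
  have ct: "count (graph ?s') (i, j) = count (graph s) (i, j) + (if i = J \<and> (J, j) \<in> F then 1 else 0)
      + (if j = J' \<and> (i, J') \<in> F \<and> i \<noteq> J then 1 else 0)" for i j
    using finF by (auto simp: count_graph_reveal count_mset_set')
  note old = compatible_count_graph[OF s]
  have "agrees E ?s'"
    unfolding agrees_def
  proof (intro allI impI)
    fix e assume e: "e \<notin> U_plus ?s' \<times> U_minus ?s'"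
    show "count (graph ?s') e = (if e \<in> E then 1 else 0)"
      using e JJ' by (cases e) (auto simp: ct old inF)
  qed
  moreover have "count (graph ?s') e = 0" if "e \<in> U_plus ?s' \<times> U_minus ?s'" for e
    using that by (cases e) (auto simp: ct old)
  moreover have "avail_plus ?s' v = deg_plus (induced E (undetermined ?s')) v" if "v \<in> U_plus ?s'" for v
  proof -
    have "avail_plus s v = deg_plus F v"
      using that s by (auto simp: compatible_def F_def)
    then show ?thesis
      using that finF deg_plus_remove[OF sub fin(2), of v J J']
      unfolding ind by (simp add: count_mset_set')
  qed
  moreover have "avail_minus ?s' v = deg_minus (induced E (undetermined ?s')) v" if "v \<in> U_minus ?s'" for v
  proof -
    have "avail_minus s v = deg_minus F v"
      using that s by (auto simp: compatible_def F_def)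
    then show ?thesis
      using that finF deg_minus_remove[OF sub fin(1), of v J' J]
      unfolding ind by (simp add: count_mset_set')
  qed
  ultimately show ?thesis
    by (auto simp: compatible_def)
qed

lemma compatible_balanced:
  assumes "compatible E s" "U_plus s \<subseteq> {1..n}" "U_minus s \<subseteq> {1..n}"
  shows "balanced n s"
    and "(\<Sum>v\<in>U_plus s. avail_plus s v) = card (induced E (undetermined s))"
    and "(\<Sum>v\<in>U_minus s. avail_minus s v) = card (induced E (undetermined s))"
proof -
  have sub: "induced E (undetermined s) \<subseteq> U_plus s \<times> U_minus s"
    by (auto simp: induced_def undetermined_def)
  have fin: "finite (U_plus s)" "finite (U_minus s)"
    using assms(2,3) finite_subset by auto
  show p: "(\<Sum>v\<in>U_plus s. avail_plus s v) = card (induced E (undetermined s))"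
    unfolding sum_deg_plus[OF sub fin, symmetric]
    using assms(1) by (intro sum.cong) (simp_all add: compatible_def)
  show m: "(\<Sum>v\<in>U_minus s. avail_minus s v) = card (induced E (undetermined s))"
    unfolding sum_deg_minus[OF sub fin, symmetric]
    using assms(1) by (intro sum.cong) (simp_all add: compatible_def)
  show "balanced n s"
    using p m assms(2,3) by (simp add: balanced_def)
qed

section \<open>One step of the two constructions\<close>

lemma nn_integral_measure_pmf_single:
  fixes f :: "'a \<Rightarrow> ennreal"
  assumes "\<And>x. x \<in> set_pmf p \<Longrightarrow> x \<noteq> x0 \<Longrightarrow> f x = 0"
  shows "(\<integral>\<^sup>+x. f x \<partial>measure_pmf p) = ennreal (pmf p x0) * f x0"
proof -
  have "(\<integral>\<^sup>+x. f x \<partial>measure_pmf p) = (\<Sum>x\<in>{x0}. f x * ennreal (pmf p x))"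
    using assms by (intro nn_integral_measure_pmf_support) auto
  then show ?thesis
    by (simp add: mult.commute)
qed

text \<open>
  The equality of \<open>joint_step_expl_step\<close> for a fixed \<open>J\<close> with neighbours. Only
  the draws prescribed by \<open>E\<close> contribute to the left-hand side. Their probabilities and the completion
  probability of the next state multiply to the completion probability of \<open>s\<close>, whatever the match
  \<open>J'\<close>; this constant comes out of the integral over \<open>J'\<close>.
\<close>

lemma joint_step_matched:
  fixes f :: "expl_state \<Rightarrow> ennreal" and g :: "joint_state \<Rightarrow> ennreal"
  assumes crit: "local_matching_criterion n \<Phi>" and s: "balanced n s" "compatible E s"
    and J: "J \<in> U_plus s" "avail_plus s J \<noteq> 0"
    and good: "\<And>s'. balanced n s' \<Longrightarrow> compatible E s' \<Longrightarrow> card (U_plus s) = Suc (card (U_plus s')) \<Longrightarrow>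
      g s' = ennreal (completion_prob E (undetermined s')) * f (undetermined s')"
    and bad: "\<And>s'. balanced n s' \<Longrightarrow> \<not> agrees E s' \<Longrightarrow> card (U_plus s) = Suc (card (U_plus s')) \<Longrightarrow> g s' = 0"
  shows "(\<integral>\<^sup>+D. \<integral>\<^sup>+J'. \<integral>\<^sup>+D'. g (reveal s J D J' D')
        \<partial>draw_half_edges (U_plus s - {J}) (avail_plus s) (avail_minus s J' - count D J')
        \<partial>choose_match \<Phi> (avail_minus s) (set_mset D)
        \<partial>draw_half_edges (U_minus s) (avail_minus s) (avail_plus s J))
    = ennreal (completion_prob E (undetermined s)) *
      (\<integral>\<^sup>+J'. f (U_plus s - {J}, U_minus s - {J'})
        \<partial>choose_match \<Phi> (deg_minus (induced E (undetermined s))) (induced E (undetermined s) `` {J}))"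
    (is "?L = _ * ?R")
proof -
  note fin = balanced_finite[OF s(1)]
  define F where "F = induced E (undetermined s)"
  define N where "N = F `` {J}"
  have sub: "F \<subseteq> U_plus s \<times> U_minus s"
    by (auto simp: F_def induced_def undetermined_def)
  have finN: "finite N" and NU: "N \<subseteq> U_minus s"
    using sub fin finite_subset[of N "U_minus s"] by (auto simp: N_def)
  have ap: "avail_plus s v = deg_plus F v" if "v \<in> U_plus s" for v
    using s(2) that by (simp add: compatible_def F_def)
  have am: "avail_minus s v = deg_minus F v" if "v \<in> U_minus s" for v
    using s(2) that by (simp add: compatible_def F_def)
  have apJ: "avail_plus s J = card N"
    using ap[OF J(1)] by (simp add: deg_plus_def N_def)
  have bounds: "U_plus s \<subseteq> {1..n}" "U_minus s \<subseteq> {1..n}"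
    using s(1) by (auto simp: balanced_def)
  note totals = compatible_balanced(2,3)[OF s(2) bounds, folded F_def]
  have total_rest: "(\<Sum>v\<in>U_plus s - {J}. avail_plus s v) = card F - card N"
    using totals(1) fin J(1) apJ by (simp add: sum.remove)
  have card_step: "card (U_plus s) = Suc (card (U_plus (reveal s J D J' D')))" for D J' D'
    using card.remove[OF fin(1) J(1)] by simp
  have vanish: "g (reveal s J D J' D') = 0"
    if "D \<in> set_pmf (draw_half_edges (U_minus s) (avail_minus s) (avail_plus s J))"
      "J' \<in> set_pmf (choose_match \<Phi> (avail_minus s) (set_mset D))"
      "D' \<in> set_pmf (draw_half_edges (U_plus s - {J}) (avail_plus s) (avail_minus s J' - count D J'))"
      "D \<noteq> mset_set N \<or> D' \<noteq> mset_set (F\<inverse> `` {J'} - {J})" for D J' D'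
  proof -
    note draws = reveal_draws[OF crit s(1) J that(1-3)]
    have "J' \<in> U_minus s"
      using draws(1,2) by blast
    then have "\<not> agrees E (reveal s J D J' D')"
      using reveal_agrees_imp[OF s(2) fin J(1) _ draws(1,3)] that(4)
      unfolding N_def F_def by blast
    then show ?thesis
      using bad[OF draws(4) _ card_step] by blast
  qed
  have deg_pos: "0 < deg_minus F v" if "v \<in> N" for v
  proof -
    have "J \<in> F\<inverse> `` {v}" "F\<inverse> `` {v} \<subseteq> U_plus s"
      using that sub by (auto simp: N_def)
    moreover from this have "finite (F\<inverse> `` {v})"
      using fin(1) finite_subset by blast
    ultimately show ?thesis
      unfolding deg_minus_def card_gt_0_iff by blast
  qed
  have match_support: "set_pmf (choose_match \<Phi> (avail_minus s) N) \<subseteq> N"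
  proof (rule choose_match_support[OF crit finN])
    show "N \<noteq> {}"
      using J(2) apJ by auto
    show "card N \<le> n"
      using card_mono[of "{1..n}" N] NU bounds by auto
    show "0 < avail_minus s v" if "v \<in> N" for v
      using am[of v] deg_pos[OF that] that NU by auto
  qed
  define pN where "pN = pmf (draw_half_edges (U_minus s) (avail_minus s) (card N)) (mset_set N)"
  have card_le: "card N \<le> card F"
    using totals(1) apJ fin J(1) by (metis member_le_sum zero_le)
  have pN: "pN = (\<Prod>v\<in>N. real (deg_minus F v)) / real (card F choose card N)"
    unfolding pN_def
    using pmf_draw_half_edges_mset_set[OF fin(2) NU, of "avail_minus s"] card_le totals(2) am NU
    by (auto intro!: prod.cong simp: subset_iff)
  \<comment> \<open>Only a draw in the support is subject to the vanishing of \<open>g\<close>, so the prescribed draw must be shown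
    to be possible before the second draw is considered.\<close>
  have "0 < card F choose card N"
    using card_le by simp
  then have pos: "pN \<noteq> 0"
    unfolding pN using deg_pos finN by auto
  have inner: "ennreal pN * (\<integral>\<^sup>+D'. g (reveal s J (mset_set N) J' D')
        \<partial>draw_half_edges (U_plus s - {J}) (avail_plus s) (avail_minus s J' - count (mset_set N) J'))
      = ennreal (completion_prob E (undetermined s)) * f (U_plus s - {J}, U_minus s - {J'})"
    if J': "J' \<in> set_pmf (choose_match \<Phi> (avail_minus s) N)" for J'
  proof -
    define N' where "N' = F\<inverse> `` {J'} - {J}"
    have edge: "(J, J') \<in> F"
      using J' match_support by (auto simp: N_def)
    have N'U: "N' \<subseteq> U_plus s - {J}"
      using sub by (auto simp: N'_def)
    have finN': "finite N'"
      using N'U fin finite_subset by auto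
    have "F\<inverse> `` {J'} = insert J N'" "J \<notin> N'"
      using edge by (auto simp: N'_def)
    then have "deg_minus F J' = Suc (card N')"
      using finN' by (simp add: deg_minus_def)
    then have rest: "avail_minus s J' - count (mset_set N) J' = card N'"
      using am[of J'] edge sub finN by (auto simp: N_def)
    define s' where "s' = reveal s J (mset_set N) J' (mset_set N')"
    have comp: "compatible E s'"
      using compatible_reveal[OF s(2) fin] edge unfolding s'_def N_def N'_def F_def by blast
    have U': "U_plus s' = U_plus s - {J}" "U_minus s' = U_minus s - {J'}"
      by (simp_all add: s'_def)
    have bal: "balanced n s'"
      using compatible_balanced(1)[OF comp, of n] U' bounds by auto
    have g': "g s' = ennreal (completion_prob E (undetermined s')) * f (U_plus s - {J}, U_minus s - {J'})"
      using good[OF bal comp] card_step unfolding s'_def by (simp add: undetermined_def)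
    have le': "card N' \<le> card F - card N"
      using card_remove[OF sub fin, of J J'] by (simp add: N_def N'_def)
    have pN': "pmf (draw_half_edges (U_plus s - {J}) (avail_plus s) (card N')) (mset_set N')
        = (\<Prod>v\<in>N'. real (deg_plus F v)) / real ((card F - card N) choose card N')"
      using pmf_draw_half_edges_mset_set[of "U_plus s - {J}" N' "avail_plus s"] fin N'U le' ap total_rest
      by (auto intro!: prod.cong simp: subset_iff)
    have "mset_set N \<in> set_pmf (draw_half_edges (U_minus s) (avail_minus s) (avail_plus s J))"
      using pos by (simp add: pN_def apJ set_pmf_iff)
    then have "(\<integral>\<^sup>+D'. g (reveal s J (mset_set N) J' D')
          \<partial>draw_half_edges (U_plus s - {J}) (avail_plus s) (avail_minus s J' - count (mset_set N) J'))
        = ennreal (pmf (draw_half_edges (U_plus s - {J}) (avail_plus s)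
            (avail_minus s J' - count (mset_set N) J')) (mset_set N')) * g s'"
      unfolding s'_def
      using vanish[of "mset_set N" J'] J' finN by (intro nn_integral_measure_pmf_single) (auto simp: N'_def)
    moreover have "completion_prob E (undetermined s)
        = pN * pmf (draw_half_edges (U_plus s - {J}) (avail_plus s) (card N')) (mset_set N')
          * completion_prob E (undetermined s')"
      using configuration_prob_step[OF sub fin edge] unfolding pN pN' completion_prob_def F_def[symmetric]
      by (simp add: undetermined_def U' induced_remove N_def N'_def F_def[unfolded undetermined_def])
    ultimately show ?thesis
      unfolding rest g'
      by (simp add: ennreal_mult pN_def completion_prob_def configuration_prob_pos less_imp_le mult.assoc)
  qed
  have "?L = ennreal pN * (\<integral>\<^sup>+J'. \<integral>\<^sup>+D'. g (reveal s J (mset_set N) J' D')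
        \<partial>draw_half_edges (U_plus s - {J}) (avail_plus s) (avail_minus s J' - count (mset_set N) J')
        \<partial>choose_match \<Phi> (avail_minus s) (set_mset (mset_set N)))"
    unfolding pN_def apJ[symmetric]
  proof (rule nn_integral_measure_pmf_single)
    fix D assume D: "D \<in> set_pmf (draw_half_edges (U_minus s) (avail_minus s) (avail_plus s J))"
      and ne: "D \<noteq> mset_set N"
    have "(\<integral>\<^sup>+J'. \<integral>\<^sup>+D'. g (reveal s J D J' D')
        \<partial>draw_half_edges (U_plus s - {J}) (avail_plus s) (avail_minus s J' - count D J')
        \<partial>choose_match \<Phi> (avail_minus s) (set_mset D))
      = (\<integral>\<^sup>+J'. \<integral>\<^sup>+D'. 0
        \<partial>draw_half_edges (U_plus s - {J}) (avail_plus s) (avail_minus s J' - count D J')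
        \<partial>choose_match \<Phi> (avail_minus s) (set_mset D))"
      using vanish[OF D _ _ disjI1[OF ne]] by (intro nn_integral_cong_AE AE_pmfI)
    then show "(\<integral>\<^sup>+J'. \<integral>\<^sup>+D'. g (reveal s J D J' D')
        \<partial>draw_half_edges (U_plus s - {J}) (avail_plus s) (avail_minus s J' - count D J')
        \<partial>choose_match \<Phi> (avail_minus s) (set_mset D)) = 0"
      by simp
  qed
  also have "set_mset (mset_set N) = N"
    using finN by simp
  also have "ennreal pN * (\<integral>\<^sup>+J'. \<integral>\<^sup>+D'. g (reveal s J (mset_set N) J' D')
        \<partial>draw_half_edges (U_plus s - {J}) (avail_plus s) (avail_minus s J' - count (mset_set N) J')
        \<partial>choose_match \<Phi> (avail_minus s) N)
      = (\<integral>\<^sup>+J'. ennreal (completion_prob E (undetermined s)) * f (U_plus s - {J}, U_minus s - {J'})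
        \<partial>choose_match \<Phi> (avail_minus s) N)"
    by (subst nn_integral_cmult[symmetric]) (auto intro!: nn_integral_cong_AE AE_pmfI inner)
  also have "choose_match \<Phi> (avail_minus s) N = choose_match \<Phi> (deg_minus F) N"
    using am NU by (intro choose_match_cong[OF finN]) auto
  finally show ?thesis
    by (simp add: nn_integral_cmult F_def N_def)
qed

text \<open>
  With \<open>g\<close> the expectation over the rest of the joint construction of a functional times the indicator
  of the final graph being \<open>E\<close>, and \<open>f\<close> that over the rest of the exploration, this is the induction
  step for trajectories. Equivalently, the completion probability is harmonic for the joint
  construction killed at its first disagreement with \<open>E\<close>, and the corresponding Doob transform,
  projected to the undetermined sets, is the exploration.
\<close>

lemma joint_step_expl_step:
  fixes f :: "expl_state \<Rightarrow> ennreal" and g :: "joint_state \<Rightarrow> ennreal"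
  assumes crit: "local_matching_criterion n \<Phi>" and s: "balanced n s" "compatible E s"
    and ne: "U_plus s \<noteq> {}"
    and good: "\<And>s'. balanced n s' \<Longrightarrow> compatible E s' \<Longrightarrow> card (U_plus s) = Suc (card (U_plus s')) \<Longrightarrow>
      g s' = ennreal (completion_prob E (undetermined s')) * f (undetermined s')"
    and bad: "\<And>s'. balanced n s' \<Longrightarrow> \<not> agrees E s' \<Longrightarrow> card (U_plus s) = Suc (card (U_plus s')) \<Longrightarrow> g s' = 0"
  shows "(\<integral>\<^sup>+s'. g s' \<partial>joint_step \<Phi> s)
    = ennreal (completion_prob E (undetermined s)) * (\<integral>\<^sup>+x. f x \<partial>expl_step \<Phi> E (undetermined s))"
proof -
  note fin = balanced_finite[OF s(1)]
  let ?F = "induced E (undetermined s)"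
  define K where "K J = (if ?F `` {J} = {} then return_pmf (U_plus s - {J}, U_minus s)
     else do {
       J' \<leftarrow> choose_match \<Phi> (deg_minus ?F) (?F `` {J});
       return_pmf (U_plus s - {J}, U_minus s - {J'})
     })" for J
  have expl: "expl_step \<Phi> E (undetermined s) = bind_pmf (pmf_of_set (U_plus s)) K"
    unfolding expl_step_def K_def Let_def by (simp only: undetermined_def fst_conv snd_conv)
  have "(\<integral>\<^sup>+s'. g s' \<partial>joint_step_at \<Phi> s J) = ennreal (completion_prob E (undetermined s)) * (\<integral>\<^sup>+x. f x \<partial>K J)"
    if J: "J \<in> U_plus s" for J
  proof -
    have sub: "?F \<subseteq> U_plus s \<times> U_minus s"
      by (auto simp: induced_def undetermined_def)
    have "finite (?F `` {J})"
      using sub fin(2) finite_subset[of "?F `` {J}" "U_minus s"] by auto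
    moreover have "avail_plus s J = card (?F `` {J})"
      using s(2) J by (simp add: compatible_def deg_plus_def)
    ultimately have iso_iff: "avail_plus s J = 0 \<longleftrightarrow> ?F `` {J} = {}"
      by simp
    show ?thesis
    proof (cases "avail_plus s J = 0")
      case True
      let ?s' = "s\<lparr>U_plus := U_plus s - {J}\<rparr>"
      have iso: "?F `` {J} = {}"
        using True iso_iff by simp
      have "completion_prob E (undetermined ?s') = completion_prob E (undetermined s)"
        using configuration_prob_isolated[OF sub fin(1) J iso] iso
        by (simp add: completion_prob_def undetermined_def induced_isolated)
      moreover have "g ?s' = ennreal (completion_prob E (undetermined ?s')) * f (undetermined ?s')"
        using balanced_isolated[OF s(1) J True] compatible_isolated[OF s(2) J iso]
          card.remove[OF fin(1) J] by (intro good) simp_all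
      ultimately show ?thesis
        using True iso by (simp add: joint_step_at_def K_def undetermined_def)
    next
      case False
      then have joint_eq: "joint_step_at \<Phi> s J = do {
         D \<leftarrow> draw_half_edges (U_minus s) (avail_minus s) (avail_plus s J);
         J' \<leftarrow> choose_match \<Phi> (avail_minus s) (set_mset D);
         D' \<leftarrow> draw_half_edges (U_plus s - {J}) (avail_plus s) (avail_minus s J' - count D J');
         return_pmf (reveal s J D J' D')
       }"
        by (simp add: joint_step_at_def)
      have expl_eq: "K J = do {
         J' \<leftarrow> choose_match \<Phi> (deg_minus ?F) (?F `` {J});
         return_pmf (U_plus s - {J}, U_minus s - {J'})
       }"
        using False iso_iff by (simp add: K_def)
      show ?thesis
        unfolding joint_eq expl_eq nn_integral_bind_pmf nn_integral_return_pmf[OF zero_le]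
        by (rule joint_step_matched[OF crit s J False good bad])
    qed
  qed
  then have "(\<integral>\<^sup>+J. \<integral>\<^sup>+s'. g s' \<partial>joint_step_at \<Phi> s J \<partial>pmf_of_set (U_plus s))
      = (\<integral>\<^sup>+J. ennreal (completion_prob E (undetermined s)) * (\<integral>\<^sup>+x. f x \<partial>K J) \<partial>pmf_of_set (U_plus s))"
    by (intro nn_integral_cong_AE AE_pmfI) (simp add: set_pmf_of_set[OF ne fin(1)])
  then show ?thesis
    unfolding joint_step_eq expl nn_integral_bind_pmf by (simp add: nn_integral_cmult)
qed

section \<open>Whole trajectories\<close>

lemma length_trajectory: "\<omega> \<in> set_pmf (trajectory K m s) \<Longrightarrow> length \<omega> = Suc m"
  by (induction m arbitrary: s \<omega>) auto

definition joint_measures :: "joint_state \<Rightarrow> nat measure \<times> nat measure" where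
  "joint_measures s = (joint_measure_plus s, joint_measure_minus s)"

definition expl_measures :: "(nat \<times> nat) set \<Rightarrow> expl_state \<Rightarrow> nat measure \<times> nat measure" where
  "expl_measures E x = (expl_measure_plus E x, expl_measure_minus E x)"

lemma sum_dirac_cong:
  "(\<And>v. v \<in> U \<Longrightarrow> a v = b v) \<Longrightarrow> sum_dirac U a = sum_dirac U b"
  unfolding sum_dirac_def by (rule distr_cong) auto

lemma compatible_measures:
  "compatible E s \<Longrightarrow> joint_measures s = expl_measures E (undetermined s)"
  unfolding joint_measures_def expl_measures_def joint_measure_plus_def joint_measure_minus_def
    expl_measure_plus_def expl_measure_minus_def
  by (auto simp: compatible_def undetermined_def intro!: sum_dirac_cong)

text \<open>
  The functional \<open>h\<close> is arbitrary because the induction step absorbs the measures at time 0 into it. A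
  first step to a compatible state falls under the induction hypothesis; after any other one, some
  settled edge has a wrong multiplicity and keeps it, so the indicator is zero.
\<close>

lemma trajectory_joint_expl:
  fixes h :: "(nat measure \<times> nat measure) list \<Rightarrow> ennreal"
  assumes crit: "local_matching_criterion n \<Phi>" and E: "finite E"
    and s: "balanced n s" "compatible E s" "card (U_plus s) = m"
  shows "(\<integral>\<^sup>+\<omega>. h (map joint_measures \<omega>) * indicator {\<omega>. graph (\<omega> ! m) = mset_set E} \<omega>
        \<partial>trajectory (joint_step \<Phi>) m s)
    = ennreal (completion_prob E (undetermined s)) *
      (\<integral>\<^sup>+\<omega>. h (map (expl_measures E) \<omega>) \<partial>trajectory (expl_step \<Phi> E) m (undetermined s))"
  using s
proof (induction m arbitrary: s h)
  case 0
  have U: "U_plus s = {}"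
    using 0 balanced_finite by simp
  then have ind: "induced E (undetermined s) = {}"
    by (auto simp: induced_def undetermined_def)
  have "graph s = mset_set E"
  proof (rule multiset_eqI)
    fix e show "count (graph s) e = count (mset_set E) e"
      using compatible_count_graph[OF 0(2)] U E by (cases e) (auto simp: count_mset_set')
  qed
  moreover have "completion_prob E (undetermined s) = 1"
    unfolding completion_prob_def ind by (simp add: configuration_prob_def undetermined_def U deg_minus_def)
  ultimately show ?case
    using compatible_measures[OF 0(2)] by simp
next
  case (Suc m)
  have ne: "U_plus s \<noteq> {}"
    using Suc.prems(3) by auto
  define h' where "h' xs = h (joint_measures s # xs)" for xs
  define g where "g s' = (\<integral>\<^sup>+\<omega>. h' (map joint_measures \<omega>) * indicator {\<omega>. graph (\<omega> ! m) = mset_set E} \<omega>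
        \<partial>trajectory (joint_step \<Phi>) m s')" for s'
  define f where "f x = (\<integral>\<^sup>+\<omega>. h' (map (expl_measures E) \<omega>) \<partial>trajectory (expl_step \<Phi> E) m x)" for x
  have "(\<integral>\<^sup>+s'. g s' \<partial>joint_step \<Phi> s)
    = ennreal (completion_prob E (undetermined s)) * (\<integral>\<^sup>+x. f x \<partial>expl_step \<Phi> E (undetermined s))"
  proof (rule joint_step_expl_step[OF crit Suc.prems(1,2) ne])
    fix s' assume s': "balanced n s'" "compatible E s'" "card (U_plus s) = Suc (card (U_plus s'))"
    show "g s' = ennreal (completion_prob E (undetermined s')) * f (undetermined s')"
      unfolding g_def f_def using s' Suc.prems(3) by (intro Suc.IH) simp_all
  next
    fix s' assume s': "balanced n s'" "\<not> agrees E s'" "card (U_plus s) = Suc (card (U_plus s'))"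
    then obtain e where e: "e \<notin> U_plus s' \<times> U_minus s'" "count (graph s') e \<noteq> count (mset_set E) e"
      using E unfolding agrees_def not_all not_imp count_mset_set' by (elim exE conjE) simp
    have "graph (\<omega> ! m) \<noteq> mset_set E" if "\<omega> \<in> set_pmf (trajectory (joint_step \<Phi>) m s')" for \<omega>
      using trajectory_settles[OF crit s'(1) _ that e(1)] s'(3) Suc.prems(3) e(2) by auto
    then show "g s' = 0"
      unfolding g_def by (subst nn_integral_0_iff_AE) (auto simp: AE_measure_pmf_iff)
  qed
  then show ?case
    by (simp add: g_def f_def h'_def compatible_measures[OF Suc.prems(2)] indicator_def)
qed

theorem theorem1:
  fixes n t :: nat
    and \<Phi> :: "nat list \<Rightarrow> nat"
    and E :: "(nat \<times> nat) set"
    and dp dm :: "nat \<Rightarrow> nat"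
    and \<nu>p \<nu>m :: "nat measure"
  assumes "0 < n"
    and "local_matching_criterion n \<Phi>"
    and "bipartite_graph n E"
    and "\<And>i. i \<in> {1..n} \<Longrightarrow> dp i = deg_plus E i"
    and "\<And>i. i \<in> {1..n} \<Longrightarrow> dm i = deg_minus E i"
    and "t \<le> n"
    and "finite_integer_measure \<nu>p"
    and "finite_integer_measure \<nu>m"
  shows "\<P>(\<omega> in joint_construction n \<Phi> dp dm.
             (joint_measure_plus (\<omega> ! t), joint_measure_minus (\<omega> ! t)) = (\<nu>p, \<nu>m)
             \<bar> graph (\<omega> ! n) = mset_set E)
       = \<P>(\<omega> in exploration n \<Phi> E.
             (expl_measure_plus E (\<omega> ! t), expl_measure_minus E (\<omega> ! t)) = (\<nu>p, \<nu>m))"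
proof -
  define s where "s = \<lparr>U_plus = {1..n}, U_minus = {1..n}, avail_plus = dp, avail_minus = dm,
    graph = ({#} :: (nat \<times> nat) multiset)\<rparr>"
  have E: "E \<subseteq> {1..n} \<times> {1..n}"
    using assms(3) by (simp add: bipartite_graph_def)
  then have finE: "finite E"
    by (rule finite_subset) auto
  have sets: "undetermined s = ({1..n}, {1..n})"
    by (simp add: s_def undetermined_def)
  have "induced E (undetermined s) = E"
    using E by (auto simp: induced_def sets)
  then have comp: "compatible E s"
    using assms(4,5) E unfolding compatible_def agrees_def by (auto simp: s_def)
  have bal: "balanced n s"
    by (rule compatible_balanced(1)[OF comp]) (simp_all add: s_def)
  have card: "card (U_plus s) = n"
    by (simp add: s_def)
  define c where "c = completion_prob E (undetermined s)"
  have c: "0 < c"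
    by (simp add: c_def completion_prob_def configuration_prob_pos)
  note key = trajectory_joint_expl[OF assms(2) finE bal comp card, folded c_def]
  define \<nu> where "\<nu> = (\<nu>p, \<nu>m)"
  let ?P = "joint_construction n \<Phi> dp dm" and ?Q = "exploration n \<Phi> E"
  have P: "?P = trajectory (joint_step \<Phi>) n s"
    by (simp add: joint_construction_def s_def)
  have Q: "?Q = trajectory (expl_step \<Phi> E) n (undetermined s)"
    by (simp add: exploration_def sets)
  have "(\<integral>\<^sup>+\<omega>. indicator {xs. xs ! t = \<nu>} (map joint_measures \<omega>) * indicator {\<omega>. graph (\<omega> ! n) = mset_set E} \<omega> \<partial>?P)
      = (\<integral>\<^sup>+\<omega>. indicator {\<omega>. joint_measures (\<omega> ! t) = \<nu> \<and> graph (\<omega> ! n) = mset_set E} \<omega> \<partial>?P)"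
    using assms(6) unfolding P
    by (intro nn_integral_cong_AE AE_pmfI) (auto simp: indicator_def dest!: length_trajectory)
  moreover have "(\<integral>\<^sup>+\<omega>. indicator {xs. xs ! t = \<nu>} (map (expl_measures E) \<omega>) \<partial>?Q)
      = (\<integral>\<^sup>+\<omega>. indicator {\<omega>. expl_measures E (\<omega> ! t) = \<nu>} \<omega> \<partial>?Q)"
    using assms(6) unfolding Q
    by (intro nn_integral_cong_AE AE_pmfI) (auto simp: indicator_def dest!: length_trajectory)
  ultimately have joint: "measure ?P {\<omega>. joint_measures (\<omega> ! t) = \<nu> \<and> graph (\<omega> ! n) = mset_set E}
      = c * measure ?Q {\<omega>. expl_measures E (\<omega> ! t) = \<nu>}"
    using key[of "indicator {xs. xs ! t = \<nu>}", folded P Q] c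
    by (simp add: measure_pmf.emeasure_eq_measure ennreal_mult'[symmetric] less_imp_le)
  have total: "measure ?P {\<omega>. graph (\<omega> ! n) = mset_set E} = c"
    using key[of "\<lambda>_. 1", folded P Q] c
    by (simp add: measure_pmf.emeasure_eq_measure measure_pmf.emeasure_space_1)
  show ?thesis
    using joint total c unfolding cond_prob_def \<nu>_def
    by (simp add: joint_measures_def expl_measures_def)
qed

end
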